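(* Let $\alpha > 1$ be a cardinal number, let $\mathcal T$ be a union-closed $\alpha$-tent, and let $\mathcal F$ be a family of sets. Let $\mathcal F^* := \mathcal F \setminus \{\emptyset\}$. If $\mathcal F^*$ dominates $\mathcal T$, then $\mathcal F \cup \mathcal T$ has an abundant element.
   Context: A family of sets is a subset of some power set (it may be infinite). The universe of a family $\mathcal G$ is $U_{\mathcal G} := \bigcup_{A \in \mathcal G} A$. A family is union-closed if it contains the union of any two of its members. (The family $\mathcal F$ is not assumed to be union-closed.) For a positive (finite or infinite) cardinal $\alpha$, an $\alpha$-tent is a one-dimensional poset consisting of exactly $\alpha$ minimal elements and a single greatest element (the dimension of a poset is the supremum of $|C|-1$ over its finite nonempty chains $C$, so the greatest element is not minimal); a family of sets $\mathcal T$ is an $\alpha$-tent if $(\mathcal T, \subseteq)$ is an $\alpha$-tent. A family $\mathcal F$ dominates a family $\mathcal G$ if for all $A \in \mathcal F$ there exists $B \in \mathcal G$ such that $A \supseteq B$. An element $x \in U_{\mathcal G}$ is abundant in a (not necessarily union-closed) family $\mathcal G$ if there exists an injective map of sets $\{A \in \mathcal G : x \notin A\} \hookrightarrow \{A \in \mathcal G : x \in A\}$; $\mathcal G$ has an abundant element if some $x \in U_{\mathcal G}$ is abundant in $\mathcal G$. *)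

theory Defs
  imports Main "HOL-Library.Extended_Nat"
begin

unbundle cardinal_syntax

text \<open>
  Posets are given by a carrier \<open>P\<close> and a relation \<open>r\<close> with \<open>partial_order_on P r\<close>;
  \<open>(x, y) \<in> r\<close> means \<open>x \<le> y\<close>.
\<close>

text \<open>
  The supremum is taken in \<open>enat\<close>, so a poset with arbitrarily long finite chains has
  dimension \<open>\<infinity>\<close>. The empty poset, for which the supremum is over the empty set, gets
  dimension \<open>0\<close>.
\<close>
definition poset_dim :: "'p set \<Rightarrow> 'p rel \<Rightarrow> enat" where
  "poset_dim P r =
     Sup {enat (card C - 1) | C. C \<in> Chains r \<and> C \<subseteq> P \<and> finite C \<and> C \<noteq> {}}"

definition minimals :: "'p set \<Rightarrow> 'p rel \<Rightarrow> 'p set" where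
  "minimals P r = {x \<in> P. \<forall>y\<in>P. (y, x) \<in> r \<longrightarrow> y = x}"

definition is_greatest_in :: "'p set \<Rightarrow> 'p rel \<Rightarrow> 'p \<Rightarrow> bool" where
  "is_greatest_in P r g \<longleftrightarrow> g \<in> P \<and> (\<forall>x\<in>P. (x, g) \<in> r)"

text \<open>
  A cardinal number is a relation \<open>\<alpha>\<close> with \<open>Card_order \<alpha>\<close>; its type is independent of that of
  the poset. The equation for \<open>P\<close> says that the poset has no elements besides the minimal
  ones and the greatest one. That the greatest element is not minimal follows from the
  dimension being \<open>1\<close>.
\<close>
definition tent :: "'c rel \<Rightarrow> 'p set \<Rightarrow> 'p rel \<Rightarrow> bool" where
  "tent \<alpha> P r \<longleftrightarrow>
     Cnotzero \<alpha> \<and>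
     partial_order_on P r \<and>
     poset_dim P r = 1 \<and>
     |minimals P r| =o \<alpha> \<and>
     (\<exists>g. is_greatest_in P r g \<and> P = insert g (minimals P r))"

definition tent_family :: "'c rel \<Rightarrow> 'a set set \<Rightarrow> bool" where
  "tent_family \<alpha> \<T> \<longleftrightarrow> tent \<alpha> \<T> (relation_of (\<subseteq>) \<T>)"

definition union_closed :: "'a set set \<Rightarrow> bool" where
  "union_closed \<F> \<longleftrightarrow> (\<forall>A\<in>\<F>. \<forall>B\<in>\<F>. A \<union> B \<in> \<F>)"

definition dominates :: "'a set set \<Rightarrow> 'a set set \<Rightarrow> bool" where
  "dominates \<F> \<G> \<longleftrightarrow> (\<forall>A\<in>\<F>. \<exists>B\<in>\<G>. A \<supseteq> B)"

definition abundant :: "'a \<Rightarrow> 'a set set \<Rightarrow> bool" where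
  "abundant x \<G> \<longleftrightarrow>
     x \<in> \<Union>\<G> \<and> (\<exists>f. inj_on f {A \<in> \<G>. x \<notin> A} \<and> f ` {A \<in> \<G>. x \<notin> A} \<subseteq> {A \<in> \<G>. x \<in> A})"

definition has_abundant_element :: "'a set set \<Rightarrow> bool" where
  "has_abundant_element \<G> \<longleftrightarrow> (\<exists>x\<in>\<Union>\<G>. abundant x \<G>)"

end

theory Submission
  imports Defs
begin

text \<open>
  The union of two distinct minimal members \<open>A\<close>, \<open>B\<close> of a union-closed tent is its greatest
  member \<open>U\<close>, so the complements in \<open>U\<close> of the minimal members are nonempty and pairwise
  disjoint. Choose \<open>x \<in> U - A\<close> and \<open>y \<in> U - B\<close>. The only member of the tent that misses \<open>x\<close>
  is \<open>A\<close>, and \<open>y \<in> A\<close>. By domination every nonempty member of \<open>\<F> \<union> \<T>\<close> includes a member of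
  the tent, so it cannot miss both \<open>x\<close> and \<open>y\<close> (lemma \<open>tent_separating_pair\<close>).

  Hence the nonempty members missing \<open>x\<close> all contain \<open>y\<close> and vice versa. These two families
  are comparable in cardinality; the smaller one injects into the larger one, which consists
  of sets containing the point that the smaller one misses. The set \<open>U\<close>, which contains both
  points, lies outside the range of this injection and serves as the image of \<open>\<emptyset>\<close>
  (lemma \<open>pair_has_abundant_element\<close>).
\<close>

text \<open>
  Writing \<open>N z\<close> for the nonempty members missing \<open>z\<close>, the covering hypothesis puts \<open>N y\<close>
  among the members containing \<open>x\<close>; so an injection of \<open>N x\<close> into \<open>N y\<close> only has to be
  extended to \<open>\<emptyset>\<close>, and \<open>U\<close> is a free value since it contains \<open>y\<close>.
\<close>
lemma abundant_if_fewer_missing: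
  assumes "U \<in> \<G>" "x \<in> U" "y \<in> U"
    and cover: "\<And>S. S \<in> \<G> \<Longrightarrow> S \<noteq> {} \<Longrightarrow> x \<in> S \<or> y \<in> S"
    and fewer: "|{S \<in> \<G> - {{}}. x \<notin> S}| \<le>o |{S \<in> \<G> - {{}}. y \<notin> S}|"
  shows "abundant x \<G>"
proof -
  obtain f where f: "inj_on f {S \<in> \<G> - {{}}. x \<notin> S}"
    "f ` {S \<in> \<G> - {{}}. x \<notin> S} \<subseteq> {S \<in> \<G> - {{}}. y \<notin> S}"
    using fewer unfolding card_of_ordLeq[symmetric] by blast
  define h where "h = f({} := U)"
  have h_empty: "h {} = U" and h_eq: "\<And>S. S \<noteq> {} \<Longrightarrow> h S = f S"
    by (auto simp: h_def)
  have f_mem: "f S \<in> \<G> \<and> f S \<noteq> {} \<and> y \<notin> f S" if "S \<in> \<G>" "S \<noteq> {}" "x \<notin> S" for S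
    using f(2) that by blast
  have "inj_on h {S \<in> \<G>. x \<notin> S}"
  proof (rule inj_onI)
    fix S S' assume S: "S \<in> {S \<in> \<G>. x \<notin> S}" "S' \<in> {S \<in> \<G>. x \<notin> S}" and eq: "h S = h S'"
    show "S = S'"
    proof (cases "S = {} \<or> S' = {}")
      case True
      then show ?thesis
        using S eq h_empty h_eq[of S] h_eq[of S'] f_mem[of S] f_mem[of S'] \<open>y \<in> U\<close> by auto
    next
      case False
      then show ?thesis
        using S eq h_eq inj_onD[OF f(1), of S S'] by simp
    qed
  qed
  moreover have "h ` {S \<in> \<G>. x \<notin> S} \<subseteq> {S \<in> \<G>. x \<in> S}"
  proof (rule image_subsetI)
    fix S assume "S \<in> {S \<in> \<G>. x \<notin> S}"
    then show "h S \<in> {S \<in> \<G>. x \<in> S}"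
      using f_mem[of S] cover[of "f S"] h_empty h_eq[of S] assms(1,2) by (cases "S = {}") auto
  qed
  ultimately show ?thesis
    using assms(1,2) unfolding abundant_def by blast
qed

lemma pair_has_abundant_element:
  assumes "U \<in> \<G>" "x \<in> U" "y \<in> U"
    and cover: "\<And>S. S \<in> \<G> \<Longrightarrow> S \<noteq> {} \<Longrightarrow> x \<in> S \<or> y \<in> S"
  shows "has_abundant_element \<G>"
proof -
  have "|{S \<in> \<G> - {{}}. x \<notin> S}| \<le>o |{S \<in> \<G> - {{}}. y \<notin> S}| \<or>
        |{S \<in> \<G> - {{}}. y \<notin> S}| \<le>o |{S \<in> \<G> - {{}}. x \<notin> S}|"
    by (rule ordLeq_total[OF card_of_Well_order card_of_Well_order])
  then have "abundant x \<G> \<or> abundant y \<G>"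
  proof
    assume "|{S \<in> \<G> - {{}}. x \<notin> S}| \<le>o |{S \<in> \<G> - {{}}. y \<notin> S}|"
    then show ?thesis
      using abundant_if_fewer_missing[OF assms] by simp
  next
    assume "|{S \<in> \<G> - {{}}. y \<notin> S}| \<le>o |{S \<in> \<G> - {{}}. x \<notin> S}|"
    moreover have "y \<in> S \<or> x \<in> S" if "S \<in> \<G>" "S \<noteq> {}" for S
      using cover[OF that] by auto
    ultimately show ?thesis
      using abundant_if_fewer_missing[OF assms(1,3,2)] by simp
  qed
  moreover have "x \<in> \<Union>\<G>" "y \<in> \<Union>\<G>"
    using assms(1-3) by auto
  ultimately show ?thesis
    unfolding has_abundant_element_def by blast
qed

lemma two_elements_if_cone_less:
  assumes "cone <o \<alpha>" "|M| =o \<alpha>"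
  obtains A B where "A \<in> M" "B \<in> M" "A \<noteq> B"
proof (rule ccontr)
  assume "\<not> thesis"
  then have "inj_on (\<lambda>_. ()) M"
    using that by (auto intro: inj_onI)
  then have "|M| \<le>o cone"
    unfolding cone_def card_of_ordLeq[symmetric] by blast
  moreover have "cone <o |M|"
    using assms ordIso_symmetric ordLess_ordIso_trans by blast
  ultimately show False
    using not_ordLess_ordLeq by blast
qed

text \<open>
  The two points separate the tent because distinct minimal members cover the greatest one:
  their union lies strictly above both, hence is not minimal. A member missing \<open>x \<in> U - A\<close>
  is therefore \<open>A\<close>, a member missing \<open>y \<in> U - B\<close> is \<open>B\<close>, and \<open>A \<noteq> B\<close>.
\<close>
lemma tent_separating_pair:
  assumes "cone <o \<alpha>" and uc: "union_closed \<T>" and tent: "tent_family \<alpha> \<T>"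
  obtains U x y where "U \<in> \<T>" "x \<in> U" "y \<in> U" "\<And>D. D \<in> \<T> \<Longrightarrow> x \<in> D \<or> y \<in> D"
proof -
  define M where "M = minimals \<T> (relation_of (\<subseteq>) \<T>)"
  have M: "D \<in> M \<longleftrightarrow> D \<in> \<T> \<and> (\<forall>E\<in>\<T>. E \<subseteq> D \<longrightarrow> E = D)" for D
    unfolding M_def minimals_def relation_of_def by auto
  obtain U where U: "U \<in> \<T>" "\<And>D. D \<in> \<T> \<Longrightarrow> D \<subseteq> U" and T: "\<T> = insert U M"
    and card: "|M| =o \<alpha>"
    using tent unfolding tent_family_def tent_def is_greatest_in_def M_def[symmetric]
    by (auto simp: relation_of_def)
  obtain A B where AB: "A \<in> M" "B \<in> M" "A \<noteq> B"
    using two_elements_if_cone_less[OF assms(1) card] .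
  have union: "D \<union> E = U" if "D \<in> M" "E \<in> M" "D \<noteq> E" for D E
  proof -
    have "D \<union> E \<in> \<T>"
      using uc that M unfolding union_closed_def by blast
    moreover have "D \<union> E \<notin> M"
      using that M[of D] M[of E] M[of "D \<union> E"] by auto
    ultimately show ?thesis
      using T by blast
  qed
  have proper: "\<not> U \<subseteq> D" if "D \<in> M" "E \<in> M" "D \<noteq> E" for D E
  proof
    assume "U \<subseteq> D"
    then have "E \<subseteq> D"
      using union[OF that] by auto
    then show False
      using that M[of D] M[of E] by auto
  qed
  obtain x where x: "x \<in> U" "x \<notin> A"
    using proper[of A B] AB by auto
  obtain y where y: "y \<in> U" "y \<notin> B"
    using proper[of B A] AB by auto
  have "x \<in> D \<or> y \<in> D" if "D \<in> \<T>" for D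
  proof (cases "D = U")
    case False
    then have "D \<in> M"
      using that T by simp
    then show ?thesis
      using AB x y union[of D A] union[of D B] by auto
  qed (use x in simp)
  then show thesis
    using that[of U x y] U(1) x(1) y(1) by simp
qed

theorem theorem4p3:
  fixes \<alpha> :: "'c rel" and \<T> \<F> :: "'a set set"
  assumes "Card_order \<alpha>" and "cone <o \<alpha>"
    and "union_closed \<T>" and "tent_family \<alpha> \<T>"
    and "dominates (\<F> - {{}}) \<T>"
  shows "has_abundant_element (\<F> \<union> \<T>)"
proof -
  obtain U x y where U: "U \<in> \<T>" "x \<in> U" "y \<in> U"
    and sep: "\<And>D. D \<in> \<T> \<Longrightarrow> x \<in> D \<or> y \<in> D"
    using tent_separating_pair[OF assms(2-4)] by blast
  show ?thesis
  proof (rule pair_has_abundant_element)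
    show "U \<in> \<F> \<union> \<T>" "x \<in> U" "y \<in> U"
      using U by auto
    fix S assume S: "S \<in> \<F> \<union> \<T>" "S \<noteq> {}"
    show "x \<in> S \<or> y \<in> S"
    proof (cases "S \<in> \<T>")
      case False
      then have "S \<in> \<F> - {{}}"
        using S by simp
      then obtain D where "D \<in> \<T>" "D \<subseteq> S"
        using assms(5) unfolding dominates_def by auto
      then show ?thesis
        using sep[of D] by auto
    qed (rule sep)
  qed
qed

end
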